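(* Let $0\le\alpha\le 1$ and $\beta\ge 0$ be real numbers, and let $f\in\mathcal{A}$ satisfy $f(z)f'(z)/z\neq 0$ for all $z\in\mathbb{D}$. If at least one of the following two inequalities holds for all $z\in\mathbb{D}$: (i) $\operatorname{Re}\big(Q_{CV}(\alpha Q_{ST}+(1-\alpha)Q_{CV}+\beta Q_{SD})\big)>-\alpha/2$; (ii) $\operatorname{Re}\big(Q_{ST}(\alpha Q_{CV}+(1-\alpha)Q_{ST}+\beta Q_{SD})\big)>-\alpha/2$; then $f$ is starlike.
   Context: $\mathbb{D}=\{z\in\mathbb{C}:|z|<1\}$. $\mathcal{A}$ is the class of analytic functions $f:\mathbb{D}\to\mathbb{C}$ with $f(0)=0$ and $f'(0)=1$. For $f\in\mathcal{A}$, as functions of $z\in\mathbb{D}$: $Q_{ST}=zf'(z)/f(z)$ (with the removable singularity at $z=0$ filled in, value $1$), $Q_{CV}=1+zf''(z)/f'(z)$, and $Q_{SD}=z^2\Big(\big(f''(z)/f'(z)\big)'-\tfrac12\big(f''(z)/f'(z)\big)^2\Big)$ ($z^2$ times the Schwarzian derivative of $f$). The condition $f(z)f'(z)/z\neq0$ is understood at $z=0$ via the removable singularity (where the value is $1$). A function $f\in\mathcal{A}$ is starlike if $\operatorname{Re}Q_{ST}>0$ on $\mathbb{D}$; equivalently, $f$ is univalent and $tf(z)\in f(\mathbb{D})$ for all $z\in\mathbb{D}$, $t\in[0,1]$. *)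

theory Defs
  imports "HOL-Complex_Analysis.Complex_Analysis"
begin

abbreviation unit_disc :: "complex set" where
  "unit_disc \<equiv> ball 0 1"

text \<open>Functions on the disc are total functions on \<^typ>\<open>complex\<close>; their values outside the
  disc are irrelevant, since the disc is open and \<^const>\<open>deriv\<close> is local.\<close>

definition class_A :: "(complex \<Rightarrow> complex) set" where
  "class_A = {f. f holomorphic_on unit_disc \<and> f 0 = 0 \<and> deriv f 0 = 1}"

text \<open>The value at \<open>0\<close> fills in the removable singularity of \<open>z f'(z) / f(z)\<close> for
  \<open>f\<close> in \<^const>\<open>class_A\<close>. If \<open>f\<close> has a zero elsewhere, division by zero makes the
  value \<open>0\<close> there.\<close>

definition Q_ST :: "(complex \<Rightarrow> complex) \<Rightarrow> complex \<Rightarrow> complex" where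
  "Q_ST f z = (if z = 0 then 1 else z * deriv f z / f z)"

definition Q_CV :: "(complex \<Rightarrow> complex) \<Rightarrow> complex \<Rightarrow> complex" where
  "Q_CV f z = 1 + z * deriv (deriv f) z / deriv f z"

definition schwarzian :: "(complex \<Rightarrow> complex) \<Rightarrow> complex \<Rightarrow> complex" where
  "schwarzian f z =
     deriv (\<lambda>w. deriv (deriv f) w / deriv f w) z - 1 / 2 * (deriv (deriv f) z / deriv f z)\<^sup>2"

definition Q_SD :: "(complex \<Rightarrow> complex) \<Rightarrow> complex \<Rightarrow> complex" where
  "Q_SD f z = z\<^sup>2 * schwarzian f z"

text \<open>The function \<open>f(z) f'(z) / z\<close>, with its removable singularity at \<open>0\<close> filled in
  (the value is \<open>f'(0)\<^sup>2 = 1\<close> on \<^const>\<open>class_A\<close>).\<close>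

definition ff'_over_z :: "(complex \<Rightarrow> complex) \<Rightarrow> complex \<Rightarrow> complex" where
  "ff'_over_z f z = (if z = 0 then 1 else f z * deriv f z / z)"

text \<open>Starlikeness of a function, not to be confused with \<^const>\<open>starlike\<close>, which is a property
  of sets. A function in \<^const>\<open>class_A\<close> that vanishes at some \<open>z \<noteq> 0\<close> is not starlike: its
  quotient has a pole at \<open>z\<close>, and here \<open>Q_ST f z = 0\<close>.\<close>

definition starlike_function :: "(complex \<Rightarrow> complex) \<Rightarrow> bool" where
  "starlike_function f \<longleftrightarrow> f \<in> class_A \<and> (\<forall>z\<in>unit_disc. Re (Q_ST f z) > 0)"

end

theory Submission
  imports Defs
begin

text \<open>
  Write \<open>p = z f' / f\<close>. This is a holomorphic function on the disc with \<open>p 0 = 1\<close>, and starlikeness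
  of \<open>f\<close> says that its real part is positive. All quantities in the two hypotheses are rational
  in \<open>p\<close>, \<open>z p'\<close> and \<open>z\<^sup>2 p''\<close>: with \<open>q = 1 + z f'' / f'\<close> one has
  \<open>q = p + z p' / p\<close>, and \<open>z\<^sup>2\<close> times the Schwarzian derivative is \<open>z q' + (1 - q\<^sup>2) / 2\<close>
  (lemmas \<open>Q_CV_via_Q_ST\<close> and \<open>Q_SD_via_Q_CV\<close>).

  If \<open>Re p\<close> is not positive everywhere, look at a point \<open>z\<close> of least modulus where it fails to be
  positive. There \<open>p = \<i> a\<close> is purely imaginary, and \<open>Re p\<close>, restricted to the circle through \<open>z\<close>,
  has a minimum. The first and second derivative tests along the circle show that \<open>s = z p'\<close> is real
  and that \<open>t = z p' + z\<^sup>2 p''\<close> has nonpositive real part; the Schwarz lemma, applied to the Cayley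
  transform of \<open>p\<close> along the radius to \<open>z\<close>, gives \<open>s \<le> - (1 + a\<^sup>2) / 2\<close>. This is the second order
  Miller-Mocanu lemma, \<open>first_nonpositive_Re_point\<close>.

  At this point \<open>q = \<i> b\<close> is purely imaginary too, with \<open>b = a - s / a\<close> of the same sign as \<open>a\<close>, and
  \<open>a b = a\<^sup>2 - s \<ge> 1 / 2\<close>. The normalised Schwarzian derivative equals a real number plus
  \<open>t / (\<i> a)\<close>. Multiplication by \<open>\<i> b\<close> or \<open>\<i> a\<close> turns its real part into a positive multiple of
  \<open>Re t\<close>, so that it only decreases the expressions in the hypotheses; what remains is at most
  \<open>- \<alpha> a b \<le> - \<alpha> / 2\<close>, a contradiction.
\<close>

section \<open>Functions with positive real part up to a boundary point\<close>

text \<open>Differentiation in the angle acts on holomorphic functions as the operator \<open>\<i> z d/dz\<close>. The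
  form of the right-hand side allows the lemma to be applied twice.\<close>

lemma has_derivative_Re_along_circle:
  fixes F :: "complex \<Rightarrow> complex" and z :: complex and \<theta> :: real
  assumes "F holomorphic_on ball 0 R" and "norm z < R"
  shows "((\<lambda>\<theta>. Re (F (z * cis \<theta>))) has_real_derivative
            Re (\<i> * ((z * cis \<theta>) * deriv F (z * cis \<theta>)))) (at \<theta>)"
proof -
  have "z * exp (\<i> * of_real \<theta>) \<in> ball 0 R"
    using assms(2) by (simp add: norm_mult)
  hence F: "(F has_field_derivative deriv F (z * exp (\<i> * of_real \<theta>)))
              (at (z * exp (\<i> * of_real \<theta>)))"
    using assms(1) holomorphic_derivI by blast
  have "((\<lambda>w. F (z * exp (\<i> * w))) has_field_derivative
            deriv F (z * exp (\<i> * of_real \<theta>)) * (z * (exp (\<i> * of_real \<theta>) * \<i>))) (at (of_real \<theta>))"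
    by (rule DERIV_chain2[where f = F and g = "\<lambda>w. z * exp (\<i> * w)", OF F]) (auto intro!: derivative_eq_intros)
  from has_field_derivative_Re[OF has_vector_derivative_real_field[OF this]]
  show ?thesis
    by (simp add: cis_conv_exp mult_ac)
qed

lemma second_derivative_nonneg_at_min:
  fixes g g' :: "real \<Rightarrow> real"
  assumes g: "\<And>x. (g has_real_derivative g' x) (at x)"
    and g': "(g' has_real_derivative c) (at x)"
    and min: "\<And>y. g x \<le> g y"
  shows "g' x = 0" and "c \<ge> 0"
proof -
  show crit: "g' x = 0"
    using DERIV_local_min[OF g, of 1 x] min by simp
  show "c \<ge> 0"
  proof (rule ccontr)
    assume "\<not> c \<ge> 0"
    then obtain d where d: "d > 0" "\<And>h. h > 0 \<Longrightarrow> h < d \<Longrightarrow> g' (x + h) < 0"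
      using DERIV_neg_dec_right[OF g'] crit by auto
    obtain y where y: "x < y" "y < x + d / 2" "g (x + d / 2) - g x = (x + d / 2 - x) * g' y"
      using MVT2[of x "x + d / 2" g g'] d(1) g by auto
    have "g' y < 0"
      using d(2)[of "y - x"] y by simp
    hence "g (x + d / 2) < g x"
      using y(3) mult_pos_neg[of "d / 2" "g' y"] d(1) by simp
    thus False
      using min[of "x + d / 2"] by simp
  qed
qed

text \<open>The Cayley transform \<open>(1 - p) / (1 + p)\<close> maps into the disc, and there
  \<open>1 - norm ((1 - p) / (1 + p))\<^sup>2 = 4 * Re p / norm (1 + p)\<^sup>2\<close>; so this is the Schwarz lemma.\<close>

lemma positive_Re_lower_bound:
  fixes p :: "complex \<Rightarrow> complex"
  assumes holo: "p holomorphic_on ball 0 1" and p0: "p 0 = 1"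
    and pos: "\<And>z. norm z < 1 \<Longrightarrow> Re (p z) > 0"
    and z: "norm z < 1"
  shows "(norm (1 + p z))\<^sup>2 * (1 - (norm z)\<^sup>2) \<le> 4 * Re (p z)"
proof -
  define w where "w = (\<lambda>z. (1 - p z) / (1 + p z))"
  have norm_sq: "(norm (1 + p x))\<^sup>2 - (norm (1 - p x))\<^sup>2 = 4 * Re (p x)" for x
    by (simp add: cmod_power2) (simp add: power2_eq_square algebra_simps)
  have nz: "1 + p x \<noteq> 0" if "norm x < 1" for x
    using pos[OF that] by (auto simp: complex_eq_iff)
  have "norm (w z) \<le> norm z"
  proof (rule Schwarz_Lemma(1)[OF _ _ _ z])
    show "w holomorphic_on ball 0 1"
      unfolding w_def using nz by (intro holomorphic_intros holo) auto
    show "w 0 = 0"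
      by (simp add: w_def p0)
    show "norm (w x) < 1" if "norm x < 1" for x
    proof -
      have "(norm (1 - p x))\<^sup>2 < (norm (1 + p x))\<^sup>2"
        using norm_sq[of x] pos[OF that] by simp
      hence "norm (1 - p x) < norm (1 + p x)"
        by (rule power2_less_imp_less) simp
      thus ?thesis
        using nz[OF that] by (simp add: w_def norm_divide)
    qed
  qed
  hence "norm (1 - p z) \<le> norm z * norm (1 + p z)"
    using nz[OF z] by (simp add: w_def norm_divide divide_simps)
  hence "(norm (1 - p z))\<^sup>2 \<le> (norm z * norm (1 + p z))\<^sup>2"
    by (rule power_mono) simp
  thus ?thesis
    using norm_sq[of z] by (simp add: power_mult_distrib algebra_simps)
qed

text \<open>A boundary form of the Schwarz lemma: the lower bound above holds up to the end of the radius,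
  with equality at the end, and may be differentiated there.\<close>

lemma radial_derivative_bound:
  fixes p :: "complex \<Rightarrow> complex"
  assumes holo: "p holomorphic_on ball 0 1" and p0: "p 0 = 1" and z: "norm z < 1"
    and pos: "\<And>x. norm x < norm z \<Longrightarrow> Re (p x) > 0"
    and pz: "p z = \<i> * of_real a"
  shows "Re (z * deriv p z) \<le> - (1 + a\<^sup>2) / 2"
proof -
  define P where "P = (\<lambda>x. p (z * x))"
  have z0: "z \<noteq> 0"
    using p0 pz by (auto dest: arg_cong[where f = Re])
  have "norm (z * x) < 1" if "norm x < 1" for x
    using that z mult_left_le[of "norm x" "norm z"] by (simp add: norm_mult)
  hence "P holomorphic_on ball 0 1"
    unfolding P_def
    by (intro holomorphic_on_compose_gen[OF _ holo, unfolded o_def] holomorphic_intros) auto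
  moreover have "Re (P x) > 0" if "norm x < 1" for x
    using pos[of "z * x"] that z0 by (simp add: P_def norm_mult)
  ultimately have bound: "(norm (1 + P x))\<^sup>2 * (1 - (norm x)\<^sup>2) \<le> 4 * Re (P x)" if "norm x < 1" for x
    using positive_Re_lower_bound[of P x] that by (simp add: P_def p0)

  define k where
    "k = (\<lambda>r::real. 4 * Re (P r) - ((1 + Re (P r))\<^sup>2 + (Im (P r))\<^sup>2) * (1 - r\<^sup>2))"
  have nonneg: "k r \<ge> 0" if "0 \<le> r" "r < 1" for r
    using bound[of "of_real r"] that by (simp add: k_def cmod_power2)
  have end0: "k 1 = 0"
    by (simp add: k_def P_def pz)
  have "(p has_field_derivative deriv p z) (at (z * 1))"
    using holomorphic_derivI[OF holo, of z] z by simp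
  moreover have "((*) z has_field_derivative z) (at 1)"
    by (auto intro!: derivative_eq_intros)
  ultimately have "(P has_field_derivative deriv p z * z) (at 1)"
    unfolding P_def by (rule DERIV_chain2)
  hence "(P has_field_derivative z * deriv p z) (at (of_real 1))"
    by (simp add: mult.commute)
  hence P': "((\<lambda>r. P (of_real r)) has_vector_derivative z * deriv p z) (at 1)"
    by (rule has_vector_derivative_real_field)
  have "(k has_real_derivative 4 * Re (z * deriv p z) + 2 * (1 + a\<^sup>2)) (at 1)"
    unfolding k_def
    by (rule derivative_eq_intros has_field_derivative_Re[OF P'] has_field_derivative_Im[OF P'] refl)+
       (simp add: P_def pz)
  hence "\<not> 0 < 4 * Re (z * deriv p z) + 2 * (1 + a\<^sup>2)"
  proof (intro notI)
    assume "(k has_real_derivative 4 * Re (z * deriv p z) + 2 * (1 + a\<^sup>2)) (at 1)"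
      and "0 < 4 * Re (z * deriv p z) + 2 * (1 + a\<^sup>2)"
    then obtain d where d: "d > 0" "\<And>h. h > 0 \<Longrightarrow> h < d \<Longrightarrow> k (1 - h) < k 1"
      using DERIV_pos_inc_left by blast
    have "k (1 - min 1 (d / 2)) < 0"
      using d(2)[of "min 1 (d / 2)"] d(1) end0 by auto
    thus False
      using nonneg[of "1 - min 1 (d / 2)"] d(1) by auto
  qed
  thus ?thesis
    by simp
qed

text \<open>The second order Miller-Mocanu lemma. The point found is one of least modulus where the real
  part is not positive.\<close>

lemma first_nonpositive_Re_point:
  fixes p :: "complex \<Rightarrow> complex"
  assumes holo: "p holomorphic_on ball 0 1" and p0: "p 0 = 1"
    and z1: "norm z1 < 1" "Re (p z1) \<le> 0"
  obtains z a s where "norm z < 1" and "z \<noteq> 0" and "p z = \<i> * of_real a" and "z * deriv p z = of_real s"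
    and "s \<le> - (1 + a\<^sup>2) / 2"
    and "Re (z * deriv p z + z\<^sup>2 * deriv (deriv p) z) \<le> 0"
proof -
  define K where "K = {x \<in> cball 0 (norm z1). Re (p x) \<in> {..0}}"
  have cont: "continuous_on (ball 0 1) (\<lambda>x. Re (p x))"
    by (intro continuous_intros holomorphic_on_imp_continuous_on holo)
  have "compact K"
  proof -
    have "closed (cball 0 (norm z1) \<inter> (\<lambda>x. Re (p x)) -` {..0})"
      using z1(1)
      by (intro continuous_closed_preimage continuous_on_subset[OF cont]) auto
    moreover have "cball 0 (norm z1) \<inter> (\<lambda>x. Re (p x)) -` {..0} = K"
      by (auto simp: K_def)
    ultimately have "closed K"
      by simp
    moreover have "bounded K"
      by (rule bounded_subset[of "cball 0 (norm z1)"]) (auto simp: K_def)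
    ultimately show ?thesis
      by (simp add: compact_eq_bounded_closed)
  qed
  moreover have "z1 \<in> K"
    using z1(2) by (simp add: K_def)
  ultimately obtain z where z: "z \<in> K" "\<And>x. x \<in> K \<Longrightarrow> norm z \<le> norm x"
    using continuous_attains_inf[of K norm] continuous_on_norm_id by blast
  have norm_z: "norm z < 1" and Re_le: "Re (p z) \<le> 0"
    using z(1) z1(1) by (auto simp: K_def)
  have z_nz: "z \<noteq> 0"
    using Re_le p0 by auto
  have pos: "Re (p x) > 0" if "norm x < norm z" for x
    using z(2)[of x] z(1) that by (force simp: K_def)

  \<comment> \<open>The closed disc of radius \<open>norm z\<close> is the closure of the open one, so positivity persists as
    nonnegativity on the circle through \<open>z\<close>.\<close>
  have nonneg: "Re (p x) \<ge> 0" if "norm x = norm z" for x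
  proof -
    have "x \<in> closure (ball 0 (norm z))"
      using that z_nz by simp
    moreover have "continuous_on (closure (ball 0 (norm z))) (\<lambda>x. Re (p x))"
      using norm_z z_nz by (intro continuous_on_subset[OF cont]) auto
    ultimately show ?thesis
      using continuous_ge_on_closure[of "ball 0 (norm z)" "\<lambda>x. Re (p x)" x 0] pos
      by (force simp: less_imp_le)
  qed
  have Re_z: "Re (p z) = 0"
    using Re_le nonneg[of z] by simp
  define a where "a = Im (p z)"
  have pz: "p z = \<i> * of_real a"
    using Re_z by (simp add: a_def complex_eq_iff)

  define u where "u = (\<lambda>x. x * deriv p x)"
  have holo_p': "deriv p holomorphic_on ball 0 1"
    by (intro holomorphic_deriv holo) simp
  have "u holomorphic_on ball 0 1"
    unfolding u_def by (intro holomorphic_intros holo_p')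
  hence holo_iu: "(\<lambda>x. \<i> * u x) holomorphic_on ball 0 1"
    by (intro holomorphic_intros)
  have "(deriv p has_field_derivative deriv (deriv p) z) (at z)"
    using holomorphic_derivI[OF holo_p', of z] norm_z by simp
  hence "((\<lambda>x. \<i> * u x) has_field_derivative \<i> * (deriv p z + z * deriv (deriv p) z)) (at z)"
    unfolding u_def by (auto intro!: derivative_eq_intros)
  hence deriv_iu: "deriv (\<lambda>x. \<i> * u x) z = \<i> * (deriv p z + z * deriv (deriv p) z)"
    by (rule DERIV_imp_deriv)

  have circle1: "((\<lambda>\<theta>. Re (p (z * cis \<theta>))) has_real_derivative
                    Re (\<i> * u (z * cis \<theta>))) (at \<theta>)" for \<theta>
    using has_derivative_Re_along_circle[OF holo norm_z] by (simp add: u_def)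
  have circle2: "((\<lambda>\<theta>. Re (\<i> * u (z * cis \<theta>))) has_real_derivative
                    - Re (z * deriv p z + z\<^sup>2 * deriv (deriv p) z)) (at 0)"
    using has_derivative_Re_along_circle[OF holo_iu norm_z, of 0]
    by (simp add: deriv_iu power2_eq_square algebra_simps)
  have circle_min: "Re (p (z * cis 0)) \<le> Re (p (z * cis \<theta>))" for \<theta>
    using nonneg[of "z * cis \<theta>"] Re_z by (simp add: norm_mult)
  note tests = second_derivative_nonneg_at_min[OF circle1 circle2 circle_min]

  have "Im (u z) = 0"
    using tests(1) by simp
  hence s: "z * deriv p z = of_real (Re (z * deriv p z))"
    by (simp add: u_def complex_eq_iff)
  have "Re (z * deriv p z + z\<^sup>2 * deriv (deriv p) z) \<le> 0"
    using tests(2) by simp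
  with norm_z z_nz pz s radial_derivative_bound[OF holo p0 norm_z pos pz] show ?thesis
    by (rule that)
qed

section \<open>The three quotients in terms of the first\<close>

text \<open>The function \<open>f(z) / z\<close> has a removable singularity, and vanishes nowhere.\<close>

lemma holomorphic_Q_ST:
  assumes f: "f \<in> class_A" and nz: "\<And>z. z \<in> unit_disc - {0} \<Longrightarrow> f z \<noteq> 0"
  shows "Q_ST f holomorphic_on unit_disc"
proof -
  define h where "h = (\<lambda>z. if z = 0 then deriv f 0 else (f z - f 0) / (z - 0))"
  have f': "f holomorphic_on unit_disc" "f 0 = 0" "deriv f 0 = 1"
    using f by (auto simp: class_A_def)
  have "h holomorphic_on unit_disc"
    unfolding h_def by (rule pole_lemma_open) (use f' in auto)
  moreover have "h z \<noteq> 0" if "z \<in> unit_disc" for z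
    using nz[of z] that f' by (auto simp: h_def)
  ultimately have "(\<lambda>z. deriv f z / h z) holomorphic_on unit_disc"
    using f' by (intro holomorphic_intros) auto
  moreover have "Q_ST f z = deriv f z / h z" for z
    using f' by (simp add: Q_ST_def h_def)
  ultimately show ?thesis
    by (simp add: fun_eq_iff[symmetric] cong: holomorphic_cong)
qed

text \<open>Logarithmic differentiation of \<open>z f' / f\<close>.\<close>

lemma Q_CV_via_Q_ST:
  assumes f: "f holomorphic_on unit_disc" and z: "z \<in> unit_disc - {0}"
    and nz: "f z \<noteq> 0" "deriv f z \<noteq> 0"
  shows "Q_CV f z = Q_ST f z + z * deriv (Q_ST f) z / Q_ST f z"
proof -
  have "(f has_field_derivative deriv f z) (at z)"
    using holomorphic_derivI[OF f, of z] z by simp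
  moreover have "(deriv f has_field_derivative deriv (deriv f) z) (at z)"
    using holomorphic_derivI[OF holomorphic_deriv[OF f], of z] z by simp
  ultimately have "((\<lambda>w. w * deriv f w / f w) has_field_derivative
      ((deriv f z + z * deriv (deriv f) z) * f z - z * deriv f z * deriv f z) / (f z * f z)) (at z)"
    using nz(1) by (auto intro!: derivative_eq_intros)
  hence "(Q_ST f has_field_derivative
      ((deriv f z + z * deriv (deriv f) z) * f z - z * deriv f z * deriv f z) / (f z * f z)) (at z)"
    by (rule has_field_derivative_transform_within_open[where S = "unit_disc - {0}"])
       (use z in \<open>auto simp: Q_ST_def\<close>)
  hence "deriv (Q_ST f) z =
      ((deriv f z + z * deriv (deriv f) z) * f z - z * deriv f z * deriv f z) / (f z * f z)"
    by (rule DERIV_imp_deriv)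
  thus ?thesis
    using z nz by (simp add: Q_CV_def Q_ST_def field_simps)
qed

text \<open>Away from \<open>0\<close>, the pre-Schwarzian \<open>f'' / f'\<close> is \<open>(q - 1) / z\<close> with \<open>q = Q_CV f\<close>.\<close>

lemma Q_SD_via_Q_CV:
  assumes z: "z \<noteq> 0" and q: "(Q_CV f has_field_derivative q') (at z)"
  shows "Q_SD f z = z * q' + (1 - (Q_CV f z)\<^sup>2) / 2"
proof -
  have pre: "(Q_CV f w - 1) / w = deriv (deriv f) w / deriv f w" if "w \<noteq> 0" for w
    using that by (simp add: Q_CV_def)
  have "((\<lambda>w. (Q_CV f w - 1) / w) has_field_derivative
          (q' * z - (Q_CV f z - 1)) / (z * z)) (at z)"
    using q z by (auto intro!: derivative_eq_intros)
  hence "((\<lambda>w. deriv (deriv f) w / deriv f w) has_field_derivative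
          (q' * z - (Q_CV f z - 1)) / (z * z)) (at z)"
    by (rule has_field_derivative_transform_within_open[where S = "- {0}"])
       (use z pre in auto)
  hence "deriv (\<lambda>w. deriv (deriv f) w / deriv f w) z = (q' * z - (Q_CV f z - 1)) / (z * z)"
    by (rule DERIV_imp_deriv)
  hence "Q_SD f z = z\<^sup>2 * ((q' * z - (Q_CV f z - 1)) / (z * z) - 1 / 2 * ((Q_CV f z - 1) / z)\<^sup>2)"
    by (simp only: Q_SD_def schwarzian_def pre[OF z])
  also have "\<dots> = (q' * z - (Q_CV f z - 1)) - 1 / 2 * (Q_CV f z - 1)\<^sup>2"
  proof -
    have "z\<^sup>2 * (c / (z * z) - 1 / 2 * (d / z)\<^sup>2) = c - 1 / 2 * d\<^sup>2" for c d :: complex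
      using z by (simp add: divide_simps power2_eq_square)
    thus ?thesis .
  qed
  also have "\<dots> = z * q' + (1 - (Q_CV f z)\<^sup>2) / 2"
    by (simp add: power2_eq_square field_simps)
  finally show ?thesis .
qed

text \<open>The two preceding lemmas combined, in terms of \<open>p\<close>, \<open>z p'\<close> and \<open>z p' + z\<^sup>2 p''\<close>.\<close>

lemma Q_SD_via_Q_ST:
  assumes f: "f \<in> class_A" and nz: "\<And>z. z \<in> unit_disc - {0} \<Longrightarrow> f z \<noteq> 0 \<and> deriv f z \<noteq> 0"
    and z: "z \<in> unit_disc - {0}"
  shows "Q_SD f z = z * deriv (Q_ST f) z
           + (z * deriv (Q_ST f) z + z\<^sup>2 * deriv (deriv (Q_ST f)) z) / Q_ST f z
           - (z * deriv (Q_ST f) z / Q_ST f z)\<^sup>2 + (1 - (Q_CV f z)\<^sup>2) / 2"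
proof -
  define p where "p = Q_ST f"
  have holo_f: "f holomorphic_on unit_disc"
    using f by (simp add: class_A_def)
  have holo: "p holomorphic_on unit_disc"
    unfolding p_def using holomorphic_Q_ST[OF f] nz by blast
  have p': "(p has_field_derivative deriv p z) (at z)"
    using holomorphic_derivI[OF holo, of z] z by simp
  have p'': "(deriv p has_field_derivative deriv (deriv p) z) (at z)"
    using holomorphic_derivI[OF holomorphic_deriv[OF holo], of z] z by simp
  have pz: "p z \<noteq> 0"
    using z nz[of z] by (simp add: p_def Q_ST_def)
  define q' where
    "q' = deriv p z + ((deriv p z + z * deriv (deriv p) z) * p z - z * deriv p z * deriv p z) / (p z * p z)"
  have "((\<lambda>w. p w + w * deriv p w / p w) has_field_derivative q') (at z)"
    using p' p'' pz unfolding q'_def by (auto intro!: derivative_eq_intros)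
  hence "(Q_CV f has_field_derivative q') (at z)"
    by (rule has_field_derivative_transform_within_open[where S = "unit_disc - {0}"])
       (use z nz Q_CV_via_Q_ST[OF holo_f] in \<open>auto simp: p_def\<close>)
  from Q_SD_via_Q_CV[OF _ this] have "Q_SD f z = z * q' + (1 - (Q_CV f z)\<^sup>2) / 2"
    using z by simp
  moreover have "z * q' = z * deriv p z + (z * deriv p z + z\<^sup>2 * deriv (deriv p) z) / p z
                   - (z * deriv p z / p z)\<^sup>2"
    using pz by (simp add: q'_def field_simps power2_eq_square)
  ultimately show ?thesis
    by (simp add: p_def)
qed

section \<open>Starlikeness\<close>

text \<open>At a first zero of \<open>Re p\<close> the quotients take values of this form, with \<open>s = z p'\<close> and
  \<open>t = z p' + z\<^sup>2 p''\<close>. In the Schwarzian term \<open>S\<close> everything except \<open>t / p\<close> is real, and so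
  contributes nothing to the real part after multiplication by the purely imaginary \<open>p\<close> or \<open>q\<close>.\<close>

lemma Re_products_le:
  fixes a s \<alpha> \<beta> :: real and t p q S :: complex
  assumes par: "0 \<le> \<alpha>" "\<alpha> \<le> 1" "0 \<le> \<beta>"
    and a: "a \<noteq> 0" and s: "s \<le> - (1 + a\<^sup>2) / 2" and t: "Re t \<le> 0"
    and p: "p = \<i> * of_real a" and q: "q = p + of_real s / p"
    and S: "S = of_real s + t / p - (of_real s / p)\<^sup>2 + (1 - q\<^sup>2) / 2"
  shows "Re (q * (of_real \<alpha> * p + (1 - of_real \<alpha>) * q + of_real \<beta> * S)) \<le> - \<alpha> / 2"
    and "Re (p * (of_real \<alpha> * q + (1 - of_real \<alpha>) * p + of_real \<beta> * S)) \<le> - \<alpha> / 2"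
proof -
  define b where "b = a - s / a"
  define c where "c = s + s\<^sup>2 / a\<^sup>2 + (1 + b\<^sup>2) / 2"
  have q_ib: "q = \<i> * of_real b"
    using a by (simp add: q p b_def field_simps)
  have S_eq: "S = of_real c + t / (\<i> * of_real a)"
    unfolding S q_ib by (simp add: p c_def power_mult_distrib power_divide)
  have ab: "a * b = a\<^sup>2 - s"
    using a by (simp add: b_def field_simps power2_eq_square)
  have "a * b \<ge> 1 / 2"
    unfolding ab using s by (simp add: field_simps) (smt (verit) zero_le_power2)
  hence ab_le: "\<alpha> * (a * b) \<ge> \<alpha> / 2"
    using mult_left_mono[of "1 / 2" "a * b" \<alpha>] par(1) by simp
  have "b / a = a * b / a\<^sup>2"
    using a by (simp add: power2_eq_square)
  hence "b / a \<ge> 0"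
    using \<open>a * b \<ge> 1 / 2\<close> by (simp del: times_divide_eq_left)
  have "Re (q * (of_real \<alpha> * p + (1 - of_real \<alpha>) * q + of_real \<beta> * S))
          = - \<alpha> * (a * b) - (1 - \<alpha>) * b\<^sup>2 + \<beta> * (b / a) * Re t"
    unfolding q_ib p S_eq using a
    by (simp add: Re_divide Im_divide field_simps power2_eq_square)
  moreover have "\<beta> * (b / a) * Re t \<le> 0" "(1 - \<alpha>) * b\<^sup>2 \<ge> 0"
    using par t \<open>b / a \<ge> 0\<close> by (simp_all add: mult_nonneg_nonpos del: times_divide_eq_right)
  ultimately show "Re (q * (of_real \<alpha> * p + (1 - of_real \<alpha>) * q + of_real \<beta> * S)) \<le> - \<alpha> / 2"
    using ab_le by simp
  have "Re (p * (of_real \<alpha> * q + (1 - of_real \<alpha>) * p + of_real \<beta> * S))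
          = - \<alpha> * (a * b) - (1 - \<alpha>) * a\<^sup>2 + \<beta> * Re t"
    unfolding q_ib p S_eq using a
    by (simp add: Re_divide Im_divide field_simps power2_eq_square)
  moreover have "\<beta> * Re t \<le> 0" "(1 - \<alpha>) * a\<^sup>2 \<ge> 0"
    using par t by (simp_all add: mult_nonneg_nonpos)
  ultimately show "Re (p * (of_real \<alpha> * q + (1 - of_real \<alpha>) * p + of_real \<beta> * S)) \<le> - \<alpha> / 2"
    using ab_le by simp
qed

theorem theorem2p10:
  fixes \<alpha> \<beta> :: real and f :: "complex \<Rightarrow> complex"
  assumes "0 \<le> \<alpha>" and "\<alpha> \<le> 1" and "0 \<le> \<beta>"
    and "f \<in> class_A"
    and "\<forall>z\<in>unit_disc. ff'_over_z f z \<noteq> 0"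
    and "(\<forall>z\<in>unit_disc.
            Re (Q_CV f z * (of_real \<alpha> * Q_ST f z + (1 - of_real \<alpha>) * Q_CV f z
                              + of_real \<beta> * Q_SD f z)) > - \<alpha> / 2)
       \<or> (\<forall>z\<in>unit_disc.
            Re (Q_ST f z * (of_real \<alpha> * Q_CV f z + (1 - of_real \<alpha>) * Q_ST f z
                              + of_real \<beta> * Q_SD f z)) > - \<alpha> / 2)"
  shows "starlike_function f"
proof (rule ccontr)
  assume "\<not> starlike_function f"
  then obtain z1 where z1: "norm z1 < 1" "Re (Q_ST f z1) \<le> 0"
    using assms(4) by (force simp: starlike_function_def not_less)
  have nz: "f z \<noteq> 0 \<and> deriv f z \<noteq> 0" if "z \<in> unit_disc - {0}" for z
    using assms(5)[rule_format, of z] that by (auto simp: ff'_over_z_def)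
  have "Q_ST f holomorphic_on unit_disc"
    using holomorphic_Q_ST[OF assms(4)] nz by blast
  moreover have "Q_ST f 0 = 1"
    by (simp add: Q_ST_def)
  ultimately obtain z a s where z: "norm z < 1" "z \<noteq> 0" and p: "Q_ST f z = \<i> * of_real a"
    and s: "z * deriv (Q_ST f) z = of_real s" "s \<le> - (1 + a\<^sup>2) / 2"
    and t: "Re (z * deriv (Q_ST f) z + z\<^sup>2 * deriv (deriv (Q_ST f)) z) \<le> 0"
    using z1 by (rule first_nonpositive_Re_point)
  have z_mem: "z \<in> unit_disc - {0}"
    using z by simp
  have "Q_ST f z \<noteq> 0"
    using nz[OF z_mem] z(2) by (simp add: Q_ST_def)
  hence a: "a \<noteq> 0"
    using p by auto
  have "Q_CV f z = Q_ST f z + of_real s / Q_ST f z"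
    using Q_CV_via_Q_ST[OF _ z_mem] nz[OF z_mem] assms(4) s(1) by (simp add: class_A_def)
  moreover have "Q_SD f z = of_real s
      + (z * deriv (Q_ST f) z + z\<^sup>2 * deriv (deriv (Q_ST f)) z) / Q_ST f z
      - (of_real s / Q_ST f z)\<^sup>2 + (1 - (Q_CV f z)\<^sup>2) / 2"
    using Q_SD_via_Q_ST[OF assms(4) nz z_mem] s(1) by simp
  ultimately have
    "Re (Q_CV f z * (of_real \<alpha> * Q_ST f z + (1 - of_real \<alpha>) * Q_CV f z
                       + of_real \<beta> * Q_SD f z)) \<le> - \<alpha> / 2"
    "Re (Q_ST f z * (of_real \<alpha> * Q_CV f z + (1 - of_real \<alpha>) * Q_ST f z
                       + of_real \<beta> * Q_SD f z)) \<le> - \<alpha> / 2"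
    by (rule Re_products_le[OF assms(1-3) a s(2) t p])+
  moreover have "z \<in> unit_disc"
    using z(1) by simp
  ultimately show False
    using assms(6) by (meson not_less)
qed

end
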